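(* Let $(X,D,\alpha)$ be a complete metric type space and let $f:X\to X$ be a continuous function. Let $a,\beta,\gamma,k,l,s,t$ be real constants such that $s\ge\beta\ge l$, $\gamma\ge k\ge t$, $a+k>0$ and $0\le \frac{s-l}{a+k}<\frac1\alpha$. Suppose that for all $x,y\in X$ $$a D(f(x),f(y))+\beta D(x,f(x))+\gamma D(y,f(y))+kD(x,f(y))+lD(y,f(x))\le sD(x,y)+tD(x,f^2(x)).$$ Then $f$ has a fixed point. Moreover, if $\alpha>1$, the fixed point is unique.
   Context: A metric type space $(X,D,\alpha)$ consists of a nonempty set $X$, a function $D:X\times X\to[0,\infty)$ and a constant $\alpha\ge 1$ such that: (D1) $D(x,x)=0$ for all $x\in X$, and $D(x,y)=0$ implies $x=y$; (D2) $D(x,y)=D(y,x)$ for all $x,y\in X$; (D3) $D(x,y)\le\alpha\big(D(x,z_1)+D(z_1,z_2)+\cdots+D(z_n,y)\big)$ for all $x,y,z_1,\dots,z_n\in X$, where $n\ge1$ is a fixed natural number. Convergence, Cauchy sequences, completeness and continuity are defined as for metric spaces: $x_m\to x$ means $D(x_m,x)\to0$; $(x_m)$ is Cauchy if $D(x_m,x_k)\to0$ as $m,k\to\infty$; $X$ is complete if every Cauchy sequence in $X$ converges in $X$; $f$ is continuous if $x_m\to x$ implies $f(x_m)\to f(x)$. Here $f^2=f\circ f$. *)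

theory Defs
  imports Complex_Main
begin

text \<open>
  The relaxed polygon inequality is required only for the one fixed number \<open>n\<close> of
  intermediate points, which are \<open>z 1, \<dots>, z n\<close>. The distance is a total function on the
  ambient type; nothing is assumed about its values outside \<open>X\<close>.
\<close>

locale metric_type_space =
  fixes X :: "'a set" and D :: "'a \<Rightarrow> 'a \<Rightarrow> real" and \<alpha> :: real and n :: nat
  assumes nonempty: "X \<noteq> {}"
    and nonneg: "\<And>x y. x \<in> X \<Longrightarrow> y \<in> X \<Longrightarrow> 0 \<le> D x y"
    and alpha_ge_1: "1 \<le> \<alpha>"
    and n_ge_1: "1 \<le> n"
    and refl_zero: "\<And>x. x \<in> X \<Longrightarrow> D x x = 0"
    and zero_imp_eq: "\<And>x y. x \<in> X \<Longrightarrow> y \<in> X \<Longrightarrow> D x y = 0 \<Longrightarrow> x = y"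
    and symmetric: "\<And>x y. x \<in> X \<Longrightarrow> y \<in> X \<Longrightarrow> D x y = D y x"
    and polygon: "\<And>x y (z :: nat \<Rightarrow> 'a). x \<in> X \<Longrightarrow> y \<in> X \<Longrightarrow> (\<forall>i\<in>{1..n}. z i \<in> X) \<Longrightarrow>
        D x y \<le> \<alpha> * (D x (z 1) + (\<Sum>i = 1..<n. D (z i) (z (Suc i))) + D (z n) y)"

definition mt_converges ::
  "'a set \<Rightarrow> ('a \<Rightarrow> 'a \<Rightarrow> real) \<Rightarrow> (nat \<Rightarrow> 'a) \<Rightarrow> 'a \<Rightarrow> bool" where
  "mt_converges X D u x \<longleftrightarrow>
     (\<forall>m. u m \<in> X) \<and> x \<in> X \<and> (\<lambda>m. D (u m) x) \<longlonglongrightarrow> 0"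

definition mt_Cauchy :: "'a set \<Rightarrow> ('a \<Rightarrow> 'a \<Rightarrow> real) \<Rightarrow> (nat \<Rightarrow> 'a) \<Rightarrow> bool" where
  "mt_Cauchy X D u \<longleftrightarrow>
     (\<forall>m. u m \<in> X) \<and> (\<forall>\<epsilon>>0. \<exists>N. \<forall>m\<ge>N. \<forall>k\<ge>N. D (u m) (u k) < \<epsilon>)"

definition mt_complete :: "'a set \<Rightarrow> ('a \<Rightarrow> 'a \<Rightarrow> real) \<Rightarrow> bool" where
  "mt_complete X D \<longleftrightarrow> (\<forall>u. mt_Cauchy X D u \<longrightarrow> (\<exists>x. mt_converges X D u x))"

definition mt_continuous :: "'a set \<Rightarrow> ('a \<Rightarrow> 'a \<Rightarrow> real) \<Rightarrow> ('a \<Rightarrow> 'a) \<Rightarrow> bool" where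
  "mt_continuous X D f \<longleftrightarrow>
     (\<forall>u x. mt_converges X D u x \<longrightarrow> mt_converges X D (\<lambda>m. f (u m)) (f x))"

end

theory Submission
  imports Defs
begin

text \<open>
  Write \<open>\<lambda> = (s - l) / (a + k)\<close>. Substituting \<open>y = f x\<close> in the contractive condition makes the
  \<open>l\<close>-term vanish, and \<open>k \<ge> t\<close> cancels the terms in \<open>D x (f (f x))\<close>. By \<open>\<gamma> \<ge> k\<close> and \<open>\<beta> \<ge> l\<close>,
  what is left is at least as strong as \<open>D (f x) (f (f x)) \<le> \<lambda> * D x (f x)\<close>. Hence the consecutive distances along
  every orbit of \<open>f\<close> decay like \<open>\<lambda> ^ m\<close>.

  The polygon inequality yields the triangle inequality with the factor \<open>\<alpha>\<close>, because the
  intermediate points may coincide. Chaining it along an orbit costs one factor \<open>\<alpha>\<close> per step, which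
  is affordable exactly because \<open>\<alpha> * \<lambda> < 1\<close>: the distances
  are dominated by a geometric series with ratio \<open>\<alpha> * \<lambda>\<close>. So orbits are Cauchy, and by continuity
  the limit of an orbit is a fixed point (\<open>geometric_steps_Cauchy\<close>, \<open>orbit_limit_fixed\<close>).

  Substituting two fixed points \<open>x\<close>, \<open>y\<close> in the condition gives
  \<open>(a + k) * D x y \<le> (s - l) * D x y\<close>, and \<open>\<lambda> < 1\<close> forces \<open>D x y = 0\<close>.
\<close>

context metric_type_space
begin

text \<open>
  All \<open>n\<close> intermediate points of the polygon inequality are placed at \<open>z\<close>, so that its inner sum
  is zero.
\<close>

lemma relaxed_triangle:
  assumes "x \<in> X" "y \<in> X" "z \<in> X"
  shows "D x y \<le> \<alpha> * (D x z + D z y)"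
  using polygon[of x y "\<lambda>_. z"] assms by (simp add: refl_zero)

lemma mt_converges_unique:
  assumes x: "mt_converges X D u x" and y: "mt_converges X D u y"
  shows "x = y"
proof -
  have mem: "u m \<in> X" "x \<in> X" "y \<in> X" for m
    using x y by (auto simp: mt_converges_def)
  have "(\<lambda>m. \<alpha> * (D (u m) x + D (u m) y)) \<longlonglongrightarrow> \<alpha> * (0 + 0)"
    using x y by (intro tendsto_intros) (auto simp: mt_converges_def)
  moreover have "D x y \<le> \<alpha> * (D (u m) x + D (u m) y)" for m
    using relaxed_triangle[of x y "u m"] symmetric[of x "u m"] mem by simp
  ultimately have "D x y \<le> \<alpha> * (0 + 0)"
    by (intro LIMSEQ_le_const) auto
  thus ?thesis
    using nonneg[of x y] zero_imp_eq[of x y] mem by simp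
qed

text \<open>
  The constant \<open>C = \<alpha> * d / (1 - \<alpha> * c)\<close> is the sum of the series \<open>\<alpha> * d * (\<alpha> * c) ^ j\<close> of
  bounds obtained by splitting off one step of the sequence after another. Being a solution of
  \<open>\<alpha> * d + \<alpha> * c * C = C\<close>, it makes the bound stable under splitting off one more step.
\<close>

lemma geometric_steps_bound:
  assumes mem: "\<And>m. u m \<in> X"
    and step: "\<And>m. D (u m) (u (Suc m)) \<le> c ^ m * d"
    and c: "0 \<le> c" "\<alpha> * c < 1" and d: "0 \<le> d"
  shows "D (u m) (u (m + p)) \<le> c ^ m * (\<alpha> * d / (1 - \<alpha> * c))"
proof -
  define C where "C = \<alpha> * d / (1 - \<alpha> * c)"
  have C: "\<alpha> * d + \<alpha> * c * C = C"
    using c by (simp add: C_def field_simps)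
  have "0 \<le> C"
    using c d alpha_ge_1 by (simp add: C_def)
  have "D (u m) (u (m + p)) \<le> c ^ m * C"
  proof (induction p arbitrary: m)
    case 0
    show ?case
      using mem c \<open>0 \<le> C\<close> by (simp add: refl_zero)
  next
    case (Suc p)
    have "D (u m) (u (m + Suc p)) \<le> \<alpha> * (D (u m) (u (Suc m)) + D (u (Suc m)) (u (Suc m + p)))"
      using relaxed_triangle[of "u m" "u (m + Suc p)" "u (Suc m)"] mem by simp
    also have "\<dots> \<le> \<alpha> * (c ^ m * d + c ^ Suc m * C)"
      using step[of m] Suc.IH[of "Suc m"] alpha_ge_1 by (intro mult_left_mono add_mono) auto
    also have "\<dots> = c ^ m * (\<alpha> * d + \<alpha> * c * C)"
      by (simp add: algebra_simps)
    finally show ?case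
      by (simp only: C)
  qed
  thus ?thesis
    by (simp only: C_def)
qed

lemma geometric_steps_Cauchy:
  assumes mem: "\<And>m. u m \<in> X"
    and step: "\<And>m. D (u m) (u (Suc m)) \<le> c ^ m * d"
    and c: "0 \<le> c" "\<alpha> * c < 1" and d: "0 \<le> d"
  shows "mt_Cauchy X D u"
  unfolding mt_Cauchy_def
proof (intro conjI allI impI mem)
  fix \<epsilon> :: real
  assume "\<epsilon> > 0"
  define C where "C = \<alpha> * d / (1 - \<alpha> * c)"
  have bound: "D (u m) (u k) \<le> c ^ m * C" if "m \<le> k" for m k
    using geometric_steps_bound[OF mem step c d, of m "k - m"] that by (simp add: C_def)
  have "c \<le> \<alpha> * c"
    using c alpha_ge_1 mult_right_mono[of 1 \<alpha> c] by simp
  hence "c < 1"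
    using c by simp
  hence "(\<lambda>m. c ^ m * C) \<longlonglongrightarrow> 0 * C"
    using c by (intro tendsto_intros LIMSEQ_power_zero) simp
  hence "eventually (\<lambda>m. c ^ m * C < \<epsilon>) sequentially"
    using \<open>\<epsilon> > 0\<close> by (intro order_tendstoD(2)) simp_all
  then obtain N where N: "c ^ m * C < \<epsilon>" if "m \<ge> N" for m
    by (auto simp: eventually_sequentially)
  have ordered: "D (u m) (u k) < \<epsilon>" if "N \<le> m" "m \<le> k" for m k
    using bound[OF that(2)] N[OF that(1)] by linarith
  show "\<exists>N. \<forall>m\<ge>N. \<forall>k\<ge>N. D (u m) (u k) < \<epsilon>"
  proof (intro exI allI impI)
    fix m k
    assume "m \<ge> N" "k \<ge> N"
    thus "D (u m) (u k) < \<epsilon>"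
      using ordered[of m k] ordered[of k m] symmetric[OF mem mem, of m k]
      by (cases "m \<le> k") auto
  qed
qed

text \<open>
  Applying \<open>f\<close> to an orbit shifts it by one index, so the images converge to \<open>f x\<close> by continuity and
  to \<open>x\<close> as a tail of the orbit.
\<close>

lemma orbit_limit_fixed:
  assumes cont: "mt_continuous X D f"
    and lim: "mt_converges X D (\<lambda>m. (f ^^ m) x0) x"
  shows "f x = x"
proof -
  have "mt_converges X D (\<lambda>m. (f ^^ Suc m) x0) (f x)"
    using cont lim by (simp add: mt_continuous_def)
  moreover have "mt_converges X D (\<lambda>m. (f ^^ Suc m) x0) x"
    using lim LIMSEQ_Suc[of "\<lambda>m. D ((f ^^ m) x0) x" 0]
    unfolding mt_converges_def by blast
  ultimately show ?thesis
    by (rule mt_converges_unique)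
qed

theorem orbit_contraction_fixed_point:
  assumes compl: "mt_complete X D"
    and self: "\<And>x. x \<in> X \<Longrightarrow> f x \<in> X"
    and cont: "mt_continuous X D f"
    and contr: "\<And>x. x \<in> X \<Longrightarrow> D (f x) (f (f x)) \<le> c * D x (f x)"
    and c: "0 \<le> c" "\<alpha> * c < 1"
  shows "\<exists>x\<in>X. f x = x"
proof -
  obtain x0 where x0: "x0 \<in> X"
    using nonempty by blast
  define u where "u m = (f ^^ m) x0" for m
  have u_Suc: "u (Suc m) = f (u m)" for m
    by (simp add: u_def)
  have mem: "u m \<in> X" for m
    by (induction m) (simp_all add: u_def x0 self)
  have step: "D (u m) (u (Suc m)) \<le> c ^ m * D x0 (f x0)" for m
  proof (induction m)
    case 0
    show ?case by (simp add: u_def)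
  next
    case (Suc m)
    have "D (u (Suc m)) (u (Suc (Suc m))) \<le> c * D (u m) (u (Suc m))"
      using contr[OF mem, of m] by (simp add: u_Suc)
    also have "\<dots> \<le> c * (c ^ m * D x0 (f x0))"
      using Suc.IH c by (intro mult_left_mono)
    finally show ?case by simp
  qed
  have "mt_Cauchy X D u"
    using mem step c nonneg[OF x0 self[OF x0]] by (rule geometric_steps_Cauchy)
  then obtain x where lim: "mt_converges X D u x"
    using compl by (auto simp: mt_complete_def)
  have "f x = x"
    using cont lim unfolding u_def by (rule orbit_limit_fixed)
  thus ?thesis
    using lim by (auto simp: mt_converges_def)
qed

end

theorem theorem3p9:
  fixes X :: "'a set" and D :: "'a \<Rightarrow> 'a \<Rightarrow> real" and \<alpha> :: real and n :: nat
    and f :: "'a \<Rightarrow> 'a" and a \<beta> \<gamma> k l s t :: real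
  assumes "metric_type_space X D \<alpha> n"
    and "mt_complete X D"
    and "\<forall>x\<in>X. f x \<in> X"
    and "mt_continuous X D f"
    and "s \<ge> \<beta>" and "\<beta> \<ge> l"
    and "\<gamma> \<ge> k" and "k \<ge> t"
    and "a + k > 0"
    and "0 \<le> (s - l) / (a + k)" and "(s - l) / (a + k) < 1 / \<alpha>"
    and "\<forall>x\<in>X. \<forall>y\<in>X.
        a * D (f x) (f y) + \<beta> * D x (f x) + \<gamma> * D y (f y) + k * D x (f y) + l * D y (f x)
          \<le> s * D x y + t * D x ((f ^^ 2) x)"
  shows "(\<exists>x\<in>X. f x = x) \<and> (\<alpha> > 1 \<longrightarrow> (\<exists>!x. x \<in> X \<and> f x = x))"
proof -
  interpret metric_type_space X D \<alpha> n by fact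
  note self = assms(3) and cont = assms(4)
    and coeffs = \<open>s \<ge> \<beta>\<close> \<open>\<beta> \<ge> l\<close> \<open>\<gamma> \<ge> k\<close> \<open>k \<ge> t\<close> \<open>a + k > 0\<close>
    and cond = assms(12)
  define c where "c = (s - l) / (a + k)"
  have c: "0 \<le> c" "\<alpha> * c < 1"
    using assms(10,11) alpha_ge_1 by (auto simp: c_def field_simps)
  have "c \<le> \<alpha> * c"
    using c alpha_ge_1 mult_right_mono[of 1 \<alpha> c] by simp
  hence "c < 1"
    using c(2) by linarith
  hence less: "s - l < a + k"
    using coeffs(5) by (simp add: c_def)

  have "D (f x) (f (f x)) \<le> c * D x (f x)" if x: "x \<in> X" for x
  proof -
    have nn: "0 \<le> D x (f x)" "0 \<le> D (f x) (f (f x))" "0 \<le> D x (f (f x))"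
      using self x by (auto intro: nonneg)
    have "a * D (f x) (f (f x)) + \<beta> * D x (f x) + \<gamma> * D (f x) (f (f x)) + k * D x (f (f x))
        \<le> s * D x (f x) + t * D x (f (f x))"
      using bspec[OF bspec[OF cond x], of "f x"] self x refl_zero[of "f x"]
      by (simp add: numeral_2_eq_2)
    moreover have "k * D (f x) (f (f x)) \<le> \<gamma> * D (f x) (f (f x))"
        "t * D x (f (f x)) \<le> k * D x (f (f x))" "l * D x (f x) \<le> \<beta> * D x (f x)"
      using coeffs nn by (auto intro: mult_right_mono)
    ultimately have "(a + k) * D (f x) (f (f x)) \<le> (s - l) * D x (f x)"
      by (simp add: algebra_simps)
    thus ?thesis
      using coeffs(5) by (simp add: c_def field_simps)
  qed
  hence ex: "\<exists>x\<in>X. f x = x"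
    using assms(2) self cont c by (intro orbit_contraction_fixed_point[of f c]) auto

  have uniq: "x = y" if x: "x \<in> X" "f x = x" and y: "y \<in> X" "f y = y" for x y
  proof -
    have "(a + k + l) * D x y \<le> s * D x y"
      using bspec[OF bspec[OF cond x(1)] y(1)] x y refl_zero[of x] refl_zero[of y] symmetric[of x y]
      by (simp add: numeral_2_eq_2 algebra_simps)
    hence "(a + k - (s - l)) * D x y \<le> 0"
      by (simp add: algebra_simps)
    hence "D x y \<le> 0"
      using less by (simp add: mult_le_0_iff)
    thus ?thesis
      using nonneg[of x y] zero_imp_eq[of x y] x y by simp
  qed
  show ?thesis
    using ex uniq by blast
qed

end
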